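(* There are infinitely many primes $p>3$ such that the relevance interval $(H_+;p^2)$ contains a prime, and there are infinitely many primes $p>3$ such that the relevance interval $(H_-;p^2)$ contains a prime.
   Context: Let $H_+=\{6k+1:k\ge0\}$ and $H_-=\{6k-1:k\ge 0\}$. For a prime $p>3$ let $q$ be the next larger prime. The relevance intervals are $(H_+;p^2)=\{x\in H_+: p^2\le x<q^2\}$ and $(H_-;p^2)=\{x-2 : x\in(H_+;p^2)\}\subset H_-$. *)

theory Defs
  imports "HOL-Computational_Algebra.Primes"
begin

text \<open>
  The sets are taken in the integers, because \<^term>\<open>6 * k - 1\<close> is negative for
  \<^term>\<open>k = 0\<close>. Primality of an integer includes positivity.
\<close>

definition H_plus :: "int set" where
  "H_plus = {6 * int k + 1 | k :: nat. True}"

definition H_minus :: "int set" where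
  "H_minus = {6 * int k - 1 | k :: nat. True}"

definition next_prime :: "nat \<Rightarrow> nat" where
  "next_prime p = (LEAST q. prime q \<and> p < q)"

definition relevance_plus :: "nat \<Rightarrow> int set" where
  "relevance_plus p = {x \<in> H_plus. int p ^ 2 \<le> x \<and> x < int (next_prime p) ^ 2}"

definition relevance_minus :: "nat \<Rightarrow> int set" where
  "relevance_minus p = {x - 2 | x. x \<in> relevance_plus p}"

lemma relevance_minus_subset:
  "relevance_minus p \<subseteq> H_minus"
proof
  fix y assume "y \<in> relevance_minus p"
  then obtain k :: nat where k: "y = 6 * int k + 1 - 2"
    by (auto simp: relevance_minus_def relevance_plus_def H_plus_def)
  then have "y = 6 * int k - 1" by simp
  then show "y \<in> H_minus" by (auto simp: H_minus_def)
qed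

end

theory Submission
  imports Defs "HOL-Number_Theory.Residues"
begin

text \<open>
  The relevance intervals cover all of \<^term>\<open>H_plus\<close> from 25 on: \<open>x\<close> lies in the interval of the
  largest prime \<open>p\<close> with \<open>p\<^sup>2 \<le> x\<close>, and this \<open>p\<close> grows with \<open>x\<close>. So it is enough that there are
  infinitely many primes congruent to 1 and to 5 modulo 6. The former are found among the divisors
  of \<open>a\<^sup>2 + a + 1\<close>, modulo which \<open>a\<close> has order 3; the latter among the divisors of \<open>6 * N! - 1\<close>.
\<close>

text \<open>If a product is 5 modulo 6, both factors are units modulo 6, hence 1 or 5, and they
  cannot both be 1. So either the prime factor \<open>p\<close> split off has residue 5, or the
  smaller cofactor \<open>b\<close> does and the induction continues there.\<close>

lemma exists_prime_factor_mod_6_eq_5: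
  fixes n :: nat
  assumes "n mod 6 = 5"
  shows "\<exists>p. prime p \<and> p dvd n \<and> p mod 6 = 5"
  using assms
proof (induction n rule: less_induct)
  case (less n)
  show ?case
  proof (cases "prime n")
    case True
    with less.prems show ?thesis by auto
  next
    case False
    have "n \<noteq> 1" "n > 0" using less.prems by (auto intro: Nat.gr0I)
    then obtain p where p: "prime p" "p dvd n" using prime_factor_nat by blast
    then obtain b where n: "n = p * b" by (auto elim: dvdE)
    have "b < n" using n p(1) \<open>n > 0\<close> prime_gt_1_nat[OF p(1)] by auto
    have "p mod 6 = 5 \<or> b mod 6 = 5"
    proof -
      have "(p mod 6) * (b mod 6) mod 6 = 5"
        using less.prems n by (simp add: mod_mult_eq)
      moreover have "p mod 6 \<in> {0,1,2,3,4,5}" "b mod 6 \<in> {0,1,2,3,4,5}" by auto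
      ultimately show ?thesis by auto
    qed
    then show ?thesis
      using p less.IH[OF \<open>b < n\<close>] n by (meson dvd_mult)
  qed
qed

lemma not_dvd_fact_imp_less:
  fixes p N :: nat
  assumes "prime p" "\<not> p dvd fact N"
  shows "N < p"
  using assms by (simp add: prime_dvd_fact_iff)

lemma primes_mod_6_eq_5_unbounded: "\<exists>p::nat. prime p \<and> p mod 6 = 5 \<and> p > N"
proof -
  define n :: nat where "n = 6 * fact N - 1"
  \<comment> \<open>This keeps the natural-number subtraction in \<open>n\<close> from
    truncating.\<close>
  have "fact N \<ge> (1::nat)" by (rule fact_ge_1)
  then have n1: "n + 1 = 6 * fact N" unfolding n_def by linarith
  then have "n mod 6 = 5" by presburger
  then obtain p where p: "prime p" "p dvd n" "p mod 6 = 5"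
    using exists_prime_factor_mod_6_eq_5 by blast
  have "\<not> p dvd fact N"
  proof
    assume "p dvd fact N"
    then have "p dvd n + 1" using n1 by simp
    with p(2) have "p dvd 1" using dvd_add_right_iff by blast
    with p(1) show False by simp
  qed
  with p show ?thesis using not_dvd_fact_imp_less by blast
qed

lemma prime_dvd_cyclotomic_3_not_dvd:
  fixes a p :: nat
  assumes "prime p" "p dvd a\<^sup>2 + a + 1"
  shows "\<not> p dvd a"
proof
  assume "p dvd a"
  then have "p dvd a\<^sup>2 + a" by (simp add: power2_eq_square)
  with assms(2) have "p dvd 1" using dvd_add_right_iff by blast
  with assms(1) show False by simp
qed

text \<open>Both \<open>a ^ 3\<close> and, by Fermat, \<open>a ^ (p - 1)\<close> are 1 modulo
  \<open>p\<close>. If \<open>p\<close> were 2 modulo 3, the exponents 3 and \<open>p - 1\<close>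
  would be coprime, forcing \<open>a\<close> to be 1 and \<open>p\<close> to divide 1 + 1 + 1 =
  3.\<close>

lemma prime_dvd_cyclotomic_3_mod_3:
  fixes a p :: nat
  assumes p: "prime p" "p dvd a\<^sup>2 + a + 1" "p \<noteq> 3"
  shows "p mod 3 = 1"
proof -
  have "prime (3::nat)" by simp
  have cop: "\<not> p dvd a" using p(1,2) by (rule prime_dvd_cyclotomic_3_not_dvd)
  \<comment> \<open>The cofactor is \<open>a - 1\<close>, which may be negative, so the
    factorisation is done in the integers.\<close>
  have "int (a\<^sup>2 + a + 1) dvd int a ^ 3 - 1"
    by (rule dvdI[of _ _ "int a - 1"]) (simp add: power2_eq_square power3_eq_cube algebra_simps)
  then have "[int a ^ 3 = 1] (mod int p)"
    using p(2) by (meson cong_iff_dvd_diff dvd_trans of_nat_dvd_iff)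
  then have a3: "[a ^ 3 = 1] (mod p)"
    by (metis cong_int_iff of_nat_1 of_nat_power)
  have ferm: "[a ^ (p - 1) = 1] (mod p)" using p(1) cop by (rule fermat_theorem)
  have "\<not> 3 dvd p" using p by (metis \<open>prime 3\<close> primes_dvd_imp_eq)
  moreover have "p mod 3 \<noteq> 2"
  proof
    assume "p mod 3 = 2"
    then have k: "p - 1 = 3 * (p div 3) + 1" by presburger
    have "[a ^ (p - 1) = 1 ^ (p div 3) * a ^ 1] (mod p)"
      unfolding k power_add power_mult by (intro cong_mult cong_pow a3) simp
    then have a1: "[a = 1] (mod p)" using ferm cong_trans[OF cong_sym] by fastforce
    have "[a\<^sup>2 + a + 1 = 1\<^sup>2 + 1 + 1] (mod p)"
      by (intro cong_add cong_pow a1) simp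
    then have "p dvd 1\<^sup>2 + 1 + 1" using p(2) cong_dvd_iff by blast
    then have "p dvd 3" by (simp add: numeral_3_eq_3)
    with p show False by (metis \<open>prime 3\<close> primes_dvd_imp_eq)
  qed
  ultimately show ?thesis by presburger
qed

lemma primes_mod_6_eq_1_unbounded: "\<exists>p::nat. prime p \<and> p mod 6 = 1 \<and> p > N"
proof -
  \<comment> \<open>A prime divisor of \<open>a\<^sup>2 + a + 1\<close> cannot divide
    \<open>a\<close>: the factor 6 thus excludes 2 and 3, and the factorial excludes all primes up
    to \<open>N\<close>.\<close>
  define a :: nat where "a = 6 * fact N"
  have "a > 0" by (simp add: a_def)
  then have "a\<^sup>2 + a + 1 \<noteq> 1" by simp
  then obtain p where p: "prime p" "p dvd a\<^sup>2 + a + 1" using prime_factor_nat by blast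
  have cop: "\<not> p dvd a" using p(1,2) by (rule prime_dvd_cyclotomic_3_not_dvd)
  have "p \<noteq> 3" "p \<noteq> 2" using cop by (auto simp: a_def)
  have "p mod 3 = 1" using prime_dvd_cyclotomic_3_mod_3[OF p \<open>p \<noteq> 3\<close>] .
  moreover have "odd p" using p(1) \<open>p \<noteq> 2\<close> by (metis primes_dvd_imp_eq two_is_prime_nat)
  ultimately have "p mod 6 = 1" by presburger
  moreover have "\<not> p dvd fact N" using cop by (auto simp: a_def)
  ultimately show ?thesis using not_dvd_fact_imp_less p(1) by blast
qed

lemma next_prime_prime_greater: "prime (next_prime p) \<and> p < next_prime p"
  unfolding next_prime_def by (rule LeastI_ex) (use bigger_prime in blast)

lemma H_plus_covered_by_relevance_plus:
  assumes x: "x \<in> H_plus" and r: "prime r" "int r ^ 2 \<le> x"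
  shows "\<exists>p\<ge>r. prime p \<and> x \<in> relevance_plus p"
proof -
  define S where "S = {p. prime p \<and> int p ^ 2 \<le> x}"
  have "p \<le> nat x" if "p \<in> S" for p
  proof -
    have "int p \<le> int p ^ 2" by (simp add: power2_eq_square flip: of_nat_mult)
    also have "\<dots> \<le> x" using that by (simp add: S_def)
    finally show ?thesis by linarith
  qed
  then have fin: "finite S" by (meson finite_nat_set_iff_bounded_le)
  have "r \<in> S" using r by (simp add: S_def)
  define p where "p = Max S"
  have "p \<in> S" "r \<le> p" using fin \<open>r \<in> S\<close> by (auto simp: p_def intro: Max_in)
  \<comment> \<open>By maximality of \<open>p\<close>, the square of the next prime exceeds
    \<open>x\<close>, which is the upper bound of the interval.\<close>
  moreover have "next_prime p \<notin> S"
    using fin next_prime_prime_greater[of p] Max_ge[of S "next_prime p"] unfolding p_def by linarith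
  ultimately have "x \<in> relevance_plus p"
    using x next_prime_prime_greater[of p] by (auto simp: S_def relevance_plus_def)
  with \<open>p \<in> S\<close> \<open>r \<le> p\<close> show ?thesis by (auto simp: S_def)
qed

text \<open>The predicate \<open>P\<close> lets one argument serve both halves: primality of
  \<open>x\<close> for the plus intervals, of \<open>x - 2\<close> for the minus intervals.\<close>

lemma infinite_relevance_plus:
  assumes "\<And>N::nat. \<exists>x\<in>H_plus. x > int N \<and> P x"
  shows "infinite {p. prime p \<and> p > 3 \<and> (\<exists>x\<in>relevance_plus p. P x)}"
  unfolding infinite_nat_iff_unbounded
proof
  fix m :: nat
  obtain r where r: "prime r" "r > max m 3" using bigger_prime by blast
  \<comment> \<open>Taking \<open>x\<close> beyond \<open>r\<^sup>2\<close> puts it in the interval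
    of some prime at least \<open>r\<close>, hence above both \<open>m\<close> and 3.\<close>
  obtain x where x: "x \<in> H_plus" "x > int (r\<^sup>2)" "P x" using assms by blast
  then obtain p where "p \<ge> r" "prime p" "x \<in> relevance_plus p"
    using H_plus_covered_by_relevance_plus[of x r] r(1) by auto
  with r x show "\<exists>n>m. n \<in> {p. prime p \<and> p > 3 \<and> (\<exists>x\<in>relevance_plus p. P x)}"
    by (intro exI[of _ p]) auto
qed

lemma nat_mod_6_eq_1_in_H_plus:
  assumes "n mod 6 = (1::nat)"
  shows "int n \<in> H_plus"
proof -
  have "n = 6 * (n div 6) + 1" using assms by presburger
  then have "int n = 6 * int (n div 6) + 1" by presburger
  then show ?thesis unfolding H_plus_def by blast
qed

theorem mainTheorem10:
  "infinite {p :: nat. prime p \<and> p > 3 \<and> (\<exists>x \<in> relevance_plus p. prime x)} \<and>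
   infinite {p :: nat. prime p \<and> p > 3 \<and> (\<exists>x \<in> relevance_minus p. prime x)}"
proof
  show "infinite {p :: nat. prime p \<and> p > 3 \<and> (\<exists>x \<in> relevance_plus p. prime x)}"
  proof (rule infinite_relevance_plus)
    fix N :: nat
    obtain q :: nat where "prime q" "q mod 6 = 1" "q > N"
      using primes_mod_6_eq_1_unbounded by blast
    then show "\<exists>x\<in>H_plus. x > int N \<and> prime x"
      by (intro bexI[of _ "int q"] nat_mod_6_eq_1_in_H_plus) auto
  qed
next
  have "infinite {p :: nat. prime p \<and> p > 3 \<and> (\<exists>x \<in> relevance_plus p. prime (x - 2))}"
  proof (rule infinite_relevance_plus)
    fix N :: nat
    obtain q :: nat where q: "prime q" "q mod 6 = 5" "q > N"
      using primes_mod_6_eq_5_unbounded by blast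
    \<comment> \<open>The witness in \<open>H_plus\<close> is \<open>q + 2\<close>, whose shift by
      -2 is the prime \<open>q\<close>.\<close>
    then have "(q + 2) mod 6 = 1" by presburger
    with q show "\<exists>x\<in>H_plus. x > int N \<and> prime (x - 2)"
      by (intro bexI[of _ "int (q + 2)"] nat_mod_6_eq_1_in_H_plus) auto
  qed
  moreover have "(\<exists>x \<in> relevance_plus p. prime (x - 2)) \<longleftrightarrow> (\<exists>x \<in> relevance_minus p. prime x)" for p
    unfolding relevance_minus_def by auto
  ultimately show "infinite {p :: nat. prime p \<and> p > 3 \<and> (\<exists>x \<in> relevance_minus p. prime x)}"
    by simp
qed

end
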